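(* Let $P=([n],\preceq)$ be a poset and $m\ge 2$, and put $r=m-1$. An $(m-1)$-perfect $P$-code of cardinality $2^{n-m}$ exists if and only if there are an ideal $I\in\mathcal{I}_P^{m-2}$ and elements $a_1,a_2,a_3\in[n]\setminus I$ such that (a) for all $i,j\in\{1,2,3\}$ with $i\ne j$, ${<}\{a_i,a_j\}{>}=\{a_i,a_j\}\cup I$; (b) for each $a\in[n]\setminus P^r$ there exists $i\in\{1,2,3\}$ such that $\{a_i\}\cup I\subseteq {<}\{a\}{>}$.
   Context: $[n]=\{1,\dots,n\}$ and $P=([n],\preceq)$ is a partially ordered set. Subsets of $[n]$ are identified with their characteristic vectors in $F^n=\{0,1\}^n$; $x+y$ is the symmetric difference. An ideal is a set $I\subseteq[n]$ such that $a\in I$ and $b\preceq a$ imply $b\in I$. For $X\subseteq[n]$, ${<}X{>}$ is the smallest ideal containing $X$. $\mathcal{I}_P^r$ is the set of ideals of cardinality $r$, and $P^r=\bigcup_{J\in\mathcal{I}_P^r}J$. The $P$-weight of $x\in F^n$ is $w_P(x)=|{<}x{>}|$ and $\mathcal{B}_P^r=\{x\in F^n: w_P(x)\le r\}$. A $P$-code is a subset $\mathcal{C}\subseteq F^n$; it is $r$-perfect if every $x\in F^n$ has exactly one representation $x=c+b$ with $c\in\mathcal{C}$, $b\in\mathcal{B}_P^r$.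
   Formalization: The formal theorem additionally requires that a_1, a_2, a_3 be distinct and that P^r = I ∪ {a_1,a_2,a_3}; without this the "if" direction fails (e.g. the antichain on [4] with m=2, I=∅, a_i=i). *)

theory Defs
  imports Complex_Main
begin

(* A poset on [n] is a relation P with partial_order_on {1..n} P, where (b, a) \<in> P means
   b \<preceq> a.  Vectors of F^n are identified with their supports, so F^n is Pow {1..n} and
   vector addition is sym_diff. *)

definition poset_ideal :: "nat \<Rightarrow> nat rel \<Rightarrow> nat set \<Rightarrow> bool" where
  "poset_ideal n P I \<longleftrightarrow> I \<subseteq> {1..n} \<and> (\<forall>a b. a \<in> I \<longrightarrow> (b, a) \<in> P \<longrightarrow> b \<in> I)"

definition ideal_gen :: "nat \<Rightarrow> nat rel \<Rightarrow> nat set \<Rightarrow> nat set" where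
  "ideal_gen n P X = \<Inter> {J. poset_ideal n P J \<and> X \<subseteq> J}"

definition ideals_of_card :: "nat \<Rightarrow> nat rel \<Rightarrow> nat \<Rightarrow> nat set set" where
  "ideals_of_card n P r = {J. poset_ideal n P J \<and> card J = r}"

definition ideals_union :: "nat \<Rightarrow> nat rel \<Rightarrow> nat \<Rightarrow> nat set" where
  "ideals_union n P r = \<Union> (ideals_of_card n P r)"

definition P_weight :: "nat \<Rightarrow> nat rel \<Rightarrow> nat set \<Rightarrow> nat" where
  "P_weight n P x = card (ideal_gen n P x)"

definition P_ball :: "nat \<Rightarrow> nat rel \<Rightarrow> nat \<Rightarrow> nat set set" where
  "P_ball n P r = {x \<in> Pow {1..n}. P_weight n P x \<le> r}"

definition perfect_code :: "nat \<Rightarrow> nat rel \<Rightarrow> nat \<Rightarrow> nat set set \<Rightarrow> bool" where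
  "perfect_code n P r C \<longleftrightarrow>
     C \<subseteq> Pow {1..n} \<and>
     (\<forall>x \<in> Pow {1..n}. \<exists>!(c, b). c \<in> C \<and> b \<in> P_ball n P r \<and> x = sym_diff c b)"

end

theory Submission
  imports Defs
begin

text \<open>
  Let \<open>S = P\<^sup>r\<close>. The ball of radius \<open>r\<close> consists of the subsets of the ideals of size \<open>r\<close>, and
  a perfect code of cardinality \<open>2\<^bsup>n-m\<^esup>\<close> forces it to have \<open>2\<^sup>m = 2\<^bsup>r+1\<^esup>\<close> elements. Growing \<open>S\<close>
  from an ideal of size \<open>r\<close> one element at a time adds at least \<open>2\<^bsup>r-1\<^esup>\<close> elements of the ball per step,
  hence \<open>|S| = r + 2\<close>. The codewords inside \<open>S\<close> tile the subsets of \<open>S\<close>, so there are just two of them;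
  with \<open>x\<close> their sum, exactly one of \<open>Y\<close> and \<open>Y + x\<close> lies in the ball for each \<open>Y \<subseteq> S\<close>.
  The complements in \<open>S\<close> of the ideals of size \<open>r\<close> are the edges of a graph on \<open>S\<close>, and the
  previous property forces this graph to be a triangle \<open>{a\<^sub>1, a\<^sub>2, a\<^sub>3}\<close> plus the isolated
  vertices \<open>I\<close>. Conversely, the sets that meet \<open>I\<close> in nothing and the triangle in nothing or
  everything form a code of the required kind.
\<close>

section \<open>Ideals and balls\<close>

lemma poset_idealI:
  assumes "I \<subseteq> {1..n}" "\<And>a b. a \<in> I \<Longrightarrow> (b, a) \<in> P \<Longrightarrow> b \<in> I"
  shows "poset_ideal n P I"
  using assms unfolding poset_ideal_def by simp

lemma poset_idealD: "poset_ideal n P I \<Longrightarrow> a \<in> I \<Longrightarrow> (b, a) \<in> P \<Longrightarrow> b \<in> I"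
  unfolding poset_ideal_def by simp

lemma poset_ideal_subset: "poset_ideal n P J \<Longrightarrow> J \<subseteq> {1..n}"
  unfolding poset_ideal_def by simp

lemma poset_ideal_finite: "poset_ideal n P J \<Longrightarrow> finite J"
  using finite_subset[OF poset_ideal_subset] by blast

lemma poset_ideal_Inter:
  assumes "\<A> \<noteq> {}" "\<And>J. J \<in> \<A> \<Longrightarrow> poset_ideal n P J"
  shows "poset_ideal n P (\<Inter>\<A>)"
proof (rule poset_idealI)
  obtain J where "J \<in> \<A>" using assms(1) by auto
  then show "\<Inter>\<A> \<subseteq> {1..n}" using poset_ideal_subset[OF assms(2)] Inter_lower by (metis subset_trans)
  show "b \<in> \<Inter>\<A>" if "a \<in> \<Inter>\<A>" "(b, a) \<in> P" for a b
  proof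
    show "b \<in> J" if "J \<in> \<A>" for J
      using poset_idealD[OF assms(2)[OF that]] that \<open>a \<in> \<Inter>\<A>\<close> \<open>(b, a) \<in> P\<close> by blast
  qed
qed

lemma poset_ideal_Union:
  assumes "\<And>J. J \<in> \<A> \<Longrightarrow> poset_ideal n P J"
  shows "poset_ideal n P (\<Union>\<A>)"
proof (rule poset_idealI)
  show "\<Union>\<A> \<subseteq> {1..n}" using poset_ideal_subset[OF assms] by (rule Union_least)
  show "b \<in> \<Union>\<A>" if "a \<in> \<Union>\<A>" "(b, a) \<in> P" for a b
  proof -
    obtain J where "J \<in> \<A>" "a \<in> J" using \<open>a \<in> \<Union>\<A>\<close> by auto
    then show ?thesis using poset_idealD[OF assms] that(2) by (metis UnionI)
  qed
qed

lemma poset_ideal_Int: "poset_ideal n P J \<Longrightarrow> poset_ideal n P K \<Longrightarrow> poset_ideal n P (J \<inter> K)"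
  unfolding poset_ideal_def by blast

lemma poset_ideal_Un: "poset_ideal n P J \<Longrightarrow> poset_ideal n P K \<Longrightarrow> poset_ideal n P (J \<union> K)"
  unfolding poset_ideal_def by blast

lemma poset_ideal_UNIV:
  assumes "partial_order_on {1..n} P"
  shows "poset_ideal n P {1..n}"
proof (rule poset_idealI)
  have "P \<subseteq> {1..n} \<times> {1..n}"
    using assms unfolding partial_order_on_def preorder_on_def by simp
  then show "b \<in> {1..n}" if "(b, a) \<in> P" for a b using that by blast
qed simp

lemma subset_ideal_gen: "X \<subseteq> ideal_gen n P X"
  unfolding ideal_gen_def by blast

lemma ideal_gen_least: "poset_ideal n P J \<Longrightarrow> X \<subseteq> J \<Longrightarrow> ideal_gen n P X \<subseteq> J"
  unfolding ideal_gen_def by blast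

lemma poset_ideal_ideal_gen:
  assumes "partial_order_on {1..n} P" "X \<subseteq> {1..n}"
  shows "poset_ideal n P (ideal_gen n P X)"
  unfolding ideal_gen_def
  using poset_ideal_UNIV[OF assms(1)] assms(2) by (intro poset_ideal_Inter) auto

text \<open>An element of \<open>L - K\<close> with the fewest elements below it works: anything
  strictly below it lies in \<open>L\<close> and has a smaller down-set, hence is already in
  \<open>K\<close>.\<close>

lemma ideal_add_minimal:
  assumes "partial_order_on {1..n} P" "poset_ideal n P K" "poset_ideal n P L" "K \<subset> L"
  obtains x where "x \<in> L - K" "poset_ideal n P (insert x K)"
proof -
  let ?D = "\<lambda>x. {b. (b, x) \<in> P}"
  have P: "P \<subseteq> {1..n} \<times> {1..n}" "refl_on {1..n} P" "trans P" "antisym P"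
    using assms(1) unfolding partial_order_on_def preorder_on_def by auto
  have fin: "finite (?D x)" for x
    by (rule finite_subset[of _ "{1..n}"]) (use P(1) in auto)
  obtain x0 where "x0 \<in> L - K" using assms(4) by blast
  then obtain x where x: "x \<in> L - K" "\<And>y. y \<in> L - K \<Longrightarrow> card (?D x) \<le> card (?D y)"
    using ex_has_least_nat[of "\<lambda>x. x \<in> L - K" x0 "\<lambda>x. card (?D x)"] by auto
  have xn: "x \<in> {1..n}" using x(1) assms(3) poset_ideal_subset by blast
  have "b \<in> insert x K" if b: "(b, x) \<in> P" for b
  proof (rule ccontr)
    assume c: "b \<notin> insert x K"
    have "b \<in> L - K" using b c x(1) assms(3) unfolding poset_ideal_def by blast
    then have "card (?D x) \<le> card (?D b)" using x(2) by blast
    \<comment> \<open>Reflexivity puts \<open>x\<close> into \<open>?D x\<close>, and antisymmetry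
      keeps it out of \<open>?D b\<close>.\<close>
    moreover have "?D b \<subset> ?D x"
    proof
      show "?D b \<subseteq> ?D x" using b P(3) by (auto dest: transD)
      show "?D b \<noteq> ?D x"
        using b c xn P(2) antisymD[OF P(4)] unfolding refl_on_def by blast
    qed
    ultimately show False using psubset_card_mono[OF fin] by (metis linorder_not_le)
  qed
  then have "poset_ideal n P (insert x K)"
    using assms(2) xn unfolding poset_ideal_def by blast
  then show ?thesis using that x(1) by blast
qed

text \<open>Minimal elements of \<open>L - J\<close> are added one at a time. This allows ideals of
  size at most \<open>r\<close> to be replaced by ideals of size exactly \<open>r\<close>.\<close>

lemma ideal_interpolate:
  assumes "partial_order_on {1..n} P" "poset_ideal n P K" "poset_ideal n P L" "K \<subseteq> L"
    "card K \<le> k" "k \<le> card L"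
  obtains J where "poset_ideal n P J" "K \<subseteq> J" "J \<subseteq> L" "card J = k"
proof -
  have "\<exists>J. poset_ideal n P J \<and> K \<subseteq> J \<and> J \<subseteq> L \<and> card J = k"
    using assms(5,6)
  proof (induction k rule: dec_induct)
    case base
    then show ?case using assms by auto
  next
    case (step k)
    then obtain J where J: "poset_ideal n P J" "K \<subseteq> J" "J \<subseteq> L" "card J = k" by auto
    with step have "J \<subset> L" by auto
    then obtain x where "x \<in> L - J" "poset_ideal n P (insert x J)"
      using ideal_add_minimal[OF assms(1) J(1) assms(3)] by blast
    then show ?case using J poset_ideal_finite[OF J(1)]
      by (intro exI[of _ "insert x J"]) auto
  qed
  then show ?thesis using that by blast
qed

lemma poset_ideal_ideals_union: "poset_ideal n P (ideals_union n P r)"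
  unfolding ideals_union_def ideals_of_card_def by (intro poset_ideal_Union) auto

text \<open>As \<open>{1..n}\<close> is itself an ideal, an ideal of size at most \<open>r\<close>
  grows to one of size \<open>r\<close>. The ball is thus the simplicial complex whose facets are
  the ideals of size \<open>r\<close>.\<close>

lemma mem_P_ball_iff:
  assumes "partial_order_on {1..n} P" "r \<le> n"
  shows "X \<in> P_ball n P r \<longleftrightarrow> (\<exists>J \<in> ideals_of_card n P r. X \<subseteq> J)"
proof
  assume "X \<in> P_ball n P r"
  then have X: "X \<subseteq> {1..n}" "card (ideal_gen n P X) \<le> r"
    unfolding P_ball_def P_weight_def by auto
  have g: "poset_ideal n P (ideal_gen n P X)" using poset_ideal_ideal_gen assms(1) X(1) by blast
  obtain J where "poset_ideal n P J" "ideal_gen n P X \<subseteq> J" "card J = r"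
    using ideal_interpolate[OF assms(1) g poset_ideal_UNIV[OF assms(1)] poset_ideal_subset[OF g] X(2)]
      assms(2) by auto
  then show "\<exists>J \<in> ideals_of_card n P r. X \<subseteq> J"
    unfolding ideals_of_card_def using subset_ideal_gen by blast
next
  assume "\<exists>J \<in> ideals_of_card n P r. X \<subseteq> J"
  then obtain J where J: "poset_ideal n P J" "card J = r" "X \<subseteq> J"
    unfolding ideals_of_card_def by auto
  then have "card (ideal_gen n P X) \<le> r"
    using ideal_gen_least[OF J(1,3)] poset_ideal_finite[OF J(1)] card_mono by metis
  then show "X \<in> P_ball n P r"
    using J poset_ideal_subset[OF J(1)] unfolding P_ball_def P_weight_def by auto
qed

section \<open>Counting the ball\<close>

lemma P_ball_subset_Pow_ideals_union:
  assumes "partial_order_on {1..n} P" "r \<le> n"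
  shows "P_ball n P r \<subseteq> Pow (ideals_union n P r)"
  using mem_P_ball_iff[OF assms] unfolding ideals_union_def by blast

text \<open>An ideal of size \<open>r\<close> contributes all its subsets. Each further element
  \<open>a\<close> lies in some ideal \<open>J \<subseteq> L\<close> of size \<open>r\<close>, and
  the \<open>2 ^ (r - 1)\<close> subsets of \<open>J\<close> that contain \<open>a\<close> are
  new.\<close>

lemma card_P_ball_Int_Pow_ge:
  assumes po: "partial_order_on {1..n} P" and r: "1 \<le> r" "r \<le> n"
    and L: "poset_ideal n P L" "L \<subseteq> ideals_union n P r" "card L = r + k"
  shows "2 ^ r + k * 2 ^ (r - 1) \<le> card (P_ball n P r \<inter> Pow L)"
  using L
proof (induction k arbitrary: L)
  case 0
  then have "Pow L \<subseteq> P_ball n P r"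
    using mem_P_ball_iff[OF po r(2)] unfolding ideals_of_card_def by auto
  then have "P_ball n P r \<inter> Pow L = Pow L" by blast
  then show ?case using 0 card_Pow[OF poset_ideal_finite[OF 0(1)]] by simp
next
  case (Suc k)
  have finL: "finite L" using Suc poset_ideal_finite by blast
  have empty: "poset_ideal n P {}" unfolding poset_ideal_def by simp
  obtain L' where L': "poset_ideal n P L'" "L' \<subseteq> L" "card L' = r + k"
    using ideal_interpolate[OF po empty Suc.prems(1), of "r + k"] Suc.prems(3) by auto
  have IH: "2 ^ r + k * 2 ^ (r - 1) \<le> card (P_ball n P r \<inter> Pow L')"
    using Suc L' by blast
  have "L' \<noteq> L" using L'(3) Suc.prems(3) by auto
  then obtain a where a: "a \<in> L" "a \<notin> L'" using L'(2) by blast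
  \<comment> \<open>\<open>J0\<close> serves only to bound the ideal generated by \<open>a\<close>;
    it need not lie inside \<open>L\<close>, so \<open>J\<close> is built afresh between that ideal
    and \<open>L\<close>.\<close>
  then obtain J0 where J0: "poset_ideal n P J0" "card J0 = r" "a \<in> J0"
    using Suc.prems(2) unfolding ideals_union_def ideals_of_card_def by blast
  have g: "poset_ideal n P (ideal_gen n P {a})"
    using poset_ideal_ideal_gen[OF po] a(1) poset_ideal_subset[OF Suc.prems(1)] by blast
  have gL: "ideal_gen n P {a} \<subseteq> L" using ideal_gen_least[OF Suc.prems(1)] a(1) by blast
  have gr: "card (ideal_gen n P {a}) \<le> r"
    using ideal_gen_least[OF J0(1), of "{a}"] J0 card_mono[OF poset_ideal_finite[OF J0(1)]] by auto
  obtain J where J: "poset_ideal n P J" "ideal_gen n P {a} \<subseteq> J" "J \<subseteq> L" "card J = r"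
    using ideal_interpolate[OF po g Suc.prems(1) gL gr] Suc.prems(3) by auto
  have aJ: "a \<in> J" using J(2) subset_ideal_gen by blast
  let ?A = "insert a ` Pow (J - {a})"
  have finJ: "finite J" using J poset_ideal_finite by blast
  have "inj_on (insert a) (Pow (J - {a}))" by (rule inj_onI) blast
  then have cA: "card ?A = 2 ^ (r - 1)"
    using aJ J(4) finJ by (simp add: card_image card_Pow)
  have "J \<in> ideals_of_card n P r" using J unfolding ideals_of_card_def by blast
  then have "?A \<subseteq> P_ball n P r \<inter> Pow L"
    using mem_P_ball_iff[OF po r(2)] J(3) aJ by blast
  then have "(P_ball n P r \<inter> Pow L') \<union> ?A \<subseteq> P_ball n P r \<inter> Pow L" using L'(2) by blast
  then have "card ((P_ball n P r \<inter> Pow L') \<union> ?A) \<le> card (P_ball n P r \<inter> Pow L)"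
    using finL by (intro card_mono) auto
  moreover have "card ((P_ball n P r \<inter> Pow L') \<union> ?A) = card (P_ball n P r \<inter> Pow L') + card ?A"
    using finL L'(2) a(2) finJ finite_subset[OF L'(2) finL] by (intro card_Un_disjoint) auto
  ultimately show ?case using IH cA by simp
qed

text \<open>The ball lies in \<open>Pow S\<close>, so \<open>S\<close> has at least
  \<open>r + 1\<close> elements. With exactly \<open>r + 1\<close>, the ball would be all of
  \<open>Pow S\<close>, but \<open>S\<close> is too large to be in it. With \<open>r + 3\<close> or
  more, the lower bound exceeds \<open>2 ^ (r + 1)\<close>.\<close>

lemma card_ideals_union:
  assumes po: "partial_order_on {1..n} P" and r: "1 \<le> r" "r \<le> n"
    and card: "card (P_ball n P r) = 2 ^ (r + 1)"
  shows "card (ideals_union n P r) = r + 2"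
proof -
  let ?S = "ideals_union n P r" and ?B = "P_ball n P r"
  have S: "poset_ideal n P ?S" by (rule poset_ideal_ideals_union)
  have finS: "finite ?S" using S poset_ideal_finite by blast
  have sub: "?B \<subseteq> Pow ?S" using P_ball_subset_Pow_ideals_union[OF po r(2)] .
  have "(2::nat) ^ (r + 1) \<le> 2 ^ card ?S"
    using card_mono[OF _ sub] finS card by (simp add: card_Pow)
  then have "r + 1 \<le> card ?S" by (rule power_le_imp_le_exp[rotated]) simp
  moreover have "card ?S \<noteq> r + 1"
  proof
    assume c: "card ?S = r + 1"
    have "?S \<notin> ?B"
    proof
      assume "?S \<in> ?B"
      then obtain J where "poset_ideal n P J" "card J = r" "?S \<subseteq> J"
        using mem_P_ball_iff[OF po r(2)] unfolding ideals_of_card_def by auto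
      then show False using c card_mono[of J ?S] poset_ideal_finite[of n P J] by simp
    qed
    then have "?B \<subset> Pow ?S" using sub by blast
    then have "card ?B < card (Pow ?S)" using finS by (intro psubset_card_mono) auto
    then show False using c card finS by (simp add: card_Pow)
  qed
  moreover have "card ?S \<le> r + 2"
  proof (rule ccontr)
    assume "\<not> card ?S \<le> r + 2"
    then have k: "card ?S = r + (card ?S - r)" "3 \<le> card ?S - r" by auto
    let ?k = "card ?S - r"
    \<comment> \<open>In units of \<open>2 ^ (r - 1)\<close> the lower bound is 5, while the ball
      has size 4.\<close>
    have "2 ^ r + 3 * 2 ^ (r - 1) \<le> 2 ^ r + ?k * 2 ^ (r - 1)" using k(2) by simp
    also have "\<dots> \<le> card (?B \<inter> Pow ?S)"
      using card_P_ball_Int_Pow_ge[OF po r S _ k(1)] by simp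
    also have "?B \<inter> Pow ?S = ?B" using sub by blast
    finally have "2 ^ r + 3 * 2 ^ (r - 1) \<le> (2::nat) ^ (r + 1)" using card by simp
    moreover have "(2::nat) ^ r = 2 * 2 ^ (r - 1)"
      using r(1) by (metis Suc_diff_1 less_eq_Suc_le One_nat_def power_Suc)
    ultimately show False by simp
  qed
  ultimately show ?thesis by simp
qed

section \<open>Tilings\<close>

lemma sym_diff_cancel_left: "sym_diff c (sym_diff c x) = x"
  by auto

text \<open>A factorization of the group \<open>Pow S\<close> under symmetric difference into two
  subsets. The ground set is arbitrary so that a code can be cut down to \<open>P^r\<close>.\<close>

definition tiling :: "'a set \<Rightarrow> 'a set set \<Rightarrow> 'a set set \<Rightarrow> bool" where
  "tiling S C B \<longleftrightarrow> C \<subseteq> Pow S \<and> B \<subseteq> Pow S \<and>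
    (\<forall>x \<in> Pow S. \<exists>c \<in> C. \<exists>b \<in> B. x = sym_diff c b) \<and>
    (\<forall>c \<in> C. \<forall>b \<in> B. \<forall>c' \<in> C. \<forall>b' \<in> B. sym_diff c b = sym_diff c' b' \<longrightarrow> c = c' \<and> b = b')"

lemma tilingD:
  assumes "tiling S C B"
  shows "C \<subseteq> Pow S" "B \<subseteq> Pow S"
    "x \<subseteq> S \<Longrightarrow> \<exists>c \<in> C. \<exists>b \<in> B. x = sym_diff c b"
    "c \<in> C \<Longrightarrow> b \<in> B \<Longrightarrow> c' \<in> C \<Longrightarrow> b' \<in> B \<Longrightarrow> sym_diff c b = sym_diff c' b' \<Longrightarrow> c = c' \<and> b = b'"
proof -
  show "C \<subseteq> Pow S" "B \<subseteq> Pow S" "x \<subseteq> S \<Longrightarrow> \<exists>c \<in> C. \<exists>b \<in> B. x = sym_diff c b"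
    using assms unfolding tiling_def by simp_all
  assume "c \<in> C" "b \<in> B" "c' \<in> C" "b' \<in> B" "sym_diff c b = sym_diff c' b'"
  with assms[unfolded tiling_def] show "c = c' \<and> b = b'" by metis
qed

lemma ex1_pair_iff:
  "(\<exists>!(c, b). Q c b) \<longleftrightarrow>
    (\<exists>c b. Q c b) \<and> (\<forall>c b c' b'. Q c b \<longrightarrow> Q c' b' \<longrightarrow> c = c' \<and> b = b')"
proof -
  have "(\<exists>!p. R p) \<longleftrightarrow> (\<exists>p. R p) \<and> (\<forall>p q. R p \<longrightarrow> R q \<longrightarrow> p = q)" for R :: "'a \<times> 'b \<Rightarrow> bool"
    by blast
  from this[of "case_prod Q"] show ?thesis by simp
qed

text \<open>As \<open>f\<close> maps \<open>C\<close> and \<open>B\<close> into \<open>X\<close>,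
  uniqueness at every point of \<open>X\<close> is the same as injectivity of \<open>f\<close> on
  pairs.\<close>

lemma ball_ex1_pair_iff:
  assumes "\<And>c b. c \<in> C \<Longrightarrow> b \<in> B \<Longrightarrow> f c b \<in> X"
  shows "(\<forall>x \<in> X. \<exists>!(c, b). c \<in> C \<and> b \<in> B \<and> x = f c b) \<longleftrightarrow>
    (\<forall>x \<in> X. \<exists>c \<in> C. \<exists>b \<in> B. x = f c b) \<and>
    (\<forall>c \<in> C. \<forall>b \<in> B. \<forall>c' \<in> C. \<forall>b' \<in> B. f c b = f c' b' \<longrightarrow> c = c' \<and> b = b')"
    (is "?L \<longleftrightarrow> ?E \<and> ?U")
proof
  assume L: ?L
  have ?E using L unfolding ex1_pair_iff by blast
  moreover have "c = c' \<and> b = b'"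
    if "c \<in> C" "b \<in> B" "c' \<in> C" "b' \<in> B" "f c b = f c' b'" for c b c' b'
  proof -
    have "\<exists>!(c'', b''). c'' \<in> C \<and> b'' \<in> B \<and> f c b = f c'' b''"
      using L assms that(1,2) by blast
    then show ?thesis using that unfolding ex1_pair_iff by blast
  qed
  ultimately show "?E \<and> ?U" by blast
next
  assume "?E \<and> ?U"
  then have E: ?E and U: ?U by simp_all
  show ?L
    unfolding ex1_pair_iff
  proof (intro ballI conjI allI impI)
    fix x assume "x \<in> X"
    then show "\<exists>c b. c \<in> C \<and> b \<in> B \<and> x = f c b" using E by blast
  next
    fix x c b c' b'
    assume "c \<in> C \<and> b \<in> B \<and> x = f c b" "c' \<in> C \<and> b' \<in> B \<and> x = f c' b'"
    then have "c = c' \<and> b = b'" using U by metis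
    then show "c = c'" "b = b'" by simp_all
  qed
qed

lemma perfect_code_iff_tiling: "perfect_code n P r C \<longleftrightarrow> tiling {1..n} C (P_ball n P r)"
proof (cases "C \<subseteq> Pow {1..n}")
  case True
  have B: "P_ball n P r \<subseteq> Pow {1..n}" unfolding P_ball_def by blast
  have "sym_diff c b \<in> Pow {1..n}" if "c \<in> C" "b \<in> P_ball n P r" for c b
    using that True B by auto
  then have "(\<forall>x \<in> Pow {1..n}. \<exists>!(c, b). c \<in> C \<and> b \<in> P_ball n P r \<and> x = sym_diff c b) \<longleftrightarrow>
    (\<forall>x \<in> Pow {1..n}. \<exists>c \<in> C. \<exists>b \<in> P_ball n P r. x = sym_diff c b) \<and>
    (\<forall>c \<in> C. \<forall>b \<in> P_ball n P r. \<forall>c' \<in> C. \<forall>b' \<in> P_ball n P r.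
      sym_diff c b = sym_diff c' b' \<longrightarrow> c = c' \<and> b = b')"
    by (rule ball_ex1_pair_iff)
  then show ?thesis
    unfolding perfect_code_def tiling_def using True B by argo
next
  case False
  then show ?thesis unfolding perfect_code_def tiling_def by simp
qed

text \<open>Addition is a bijection from \<open>C \<times> B\<close> onto
  \<open>Pow S\<close>.\<close>

lemma card_tiling:
  assumes t: "tiling S C B" and "finite S"
  shows "card C * card B = 2 ^ card S"
proof -
  let ?f = "\<lambda>(c, b). sym_diff c b"
  have "bij_betw ?f (C \<times> B) (Pow S)"
    unfolding bij_betw_def
  proof
    show "inj_on ?f (C \<times> B)"
    proof (rule inj_onI, clarify)
      fix c b c' b'
      assume "c \<in> C" "b \<in> B" "c' \<in> C" "b' \<in> B" "sym_diff c b = sym_diff c' b'"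
      then show "c = c' \<and> b = b'" by (rule tilingD(4)[OF t])
    qed
    show "?f ` (C \<times> B) = Pow S"
    proof
      show "?f ` (C \<times> B) \<subseteq> Pow S" using tilingD(1,2)[OF t] by fast
      show "Pow S \<subseteq> ?f ` (C \<times> B)"
      proof
        fix x assume "x \<in> Pow S"
        then obtain c b where "c \<in> C" "b \<in> B" "x = sym_diff c b" using tilingD(3)[OF t] by blast
        then show "x \<in> ?f ` (C \<times> B)" by (intro image_eqI[of _ _ "(c, b)"]) simp_all
      qed
    qed
  qed
  then have "card (C \<times> B) = card (Pow S)" by (rule bij_betw_same_card)
  then show ?thesis using assms(2) by (simp add: card_cartesian_product card_Pow)
qed

text \<open>If a sum and its summand from \<open>B\<close> both lie in \<open>S'\<close>, so does
  the codeword; hence subsets of \<open>S'\<close> are reached only from codewords inside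
  \<open>S'\<close>.\<close>

lemma tiling_restrict:
  assumes t: "tiling S C B" and S': "S' \<subseteq> S" "B \<subseteq> Pow S'"
  shows "tiling S' (C \<inter> Pow S') B"
proof -
  have "\<exists>c \<in> C \<inter> Pow S'. \<exists>b \<in> B. x = sym_diff c b" if x: "x \<subseteq> S'" for x
  proof -
    obtain c b where cb: "c \<in> C" "b \<in> B" "x = sym_diff c b"
      using tilingD(3)[OF t, of x] x S'(1) by blast
    have "c \<subseteq> x \<union> b" unfolding cb(3) by auto
    also have "\<dots> \<subseteq> S'" using x cb(2) S'(2) by blast
    finally show ?thesis using cb by blast
  qed
  moreover have "\<forall>c \<in> C \<inter> Pow S'. \<forall>b \<in> B. \<forall>c' \<in> C \<inter> Pow S'. \<forall>b' \<in> B.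
      sym_diff c b = sym_diff c' b' \<longrightarrow> c = c' \<and> b = b'"
    using tilingD(4)[OF t] by (metis IntD1)
  ultimately show ?thesis using S'(2) unfolding tiling_def by simp
qed

text \<open>Let \<open>x\<close> be the sum of the codewords \<open>c\<close> and \<open>d\<close>.
  Then \<open>c + Y = d + (Y + x)\<close>, and these are the only candidates for representing this
  vector, so exactly one of \<open>Y\<close> and \<open>Y + x\<close> is in
  \<open>B\<close>.\<close>

lemma two_codewords:
  assumes t: "tiling S C B" and "card C = 2"
  obtains x where "x \<subseteq> S" "\<And>Y. Y \<subseteq> S \<Longrightarrow> (Y \<in> B) \<noteq> (sym_diff Y x \<in> B)"
proof -
  obtain c d where C: "C = {c, d}" "c \<noteq> d" using assms(2) unfolding card_2_iff by blast
  have sub: "c \<subseteq> S" "d \<subseteq> S" using tilingD(1)[OF t] C by auto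
  define x where "x = sym_diff c d"
  have "(Y \<in> B) \<noteq> (sym_diff Y x \<in> B)" if Y: "Y \<subseteq> S" for Y
  proof -
    have z: "sym_diff c Y = sym_diff d (sym_diff Y x)" unfolding x_def by auto
    have "sym_diff c Y \<subseteq> S" using sub Y by auto
    from tilingD(3)[OF t this] obtain e b
      where eb: "e \<in> {c, d}" "b \<in> B" "sym_diff c Y = sym_diff e b" using C(1) by metis
    have "Y \<in> B \<or> sym_diff Y x \<in> B"
    proof (cases "e = c")
      case True
      then have "Y = b" using eb(3) sym_diff_cancel_left by metis
      then show ?thesis using eb(2) by simp
    next
      case False
      then have "sym_diff Y x = b" using eb(1,3) z sym_diff_cancel_left by (metis insertE singletonD)
      then show ?thesis using eb(2) by simp
    qed
    moreover have "\<not> (Y \<in> B \<and> sym_diff Y x \<in> B)"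
      using tilingD(4)[OF t _ _ _ _ z] C by blast
    ultimately show ?thesis by argo
  qed
  moreover have "x \<subseteq> S" using sub unfolding x_def by auto
  ultimately show ?thesis using that by metis
qed

section \<open>A graph-theoretic characterization of the triangle\<close>

text \<open>Testing \<open>xor\<close> on an edge shows that edges inside \<open>x\<close> pairwise
  meet; testing it on single vertices shows that no vertex of \<open>x\<close> covers them all.
  Pairwise meeting edges without a common vertex form a triangle, and any further edge would be
  disjoint from one of its sides.\<close>

lemma graph_is_triangle:
  fixes E :: "'a set set"
  assumes E: "\<And>e. e \<in> E \<Longrightarrow> e \<subseteq> S \<and> card e = 2" and x: "x \<subseteq> S"
    and xor: "\<And>Y. Y \<subseteq> S \<Longrightarrow> (\<exists>e \<in> E. e \<subseteq> Y) \<noteq> (\<exists>e \<in> E. e \<subseteq> sym_diff Y x)"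
  obtains u v w where "u \<in> S" "v \<in> S" "w \<in> S" "u \<noteq> v" "v \<noteq> w" "u \<noteq> w"
    "E = {{u, v}, {v, w}, {u, w}}"
proof -
  have small: "\<not> (\<exists>e \<in> E. e \<subseteq> Y)" if Y: "Y \<subseteq> {y}" for Y y
  proof
    assume "\<exists>e \<in> E. e \<subseteq> Y"
    then obtain e where "e \<subseteq> {y}" "card e = 2" using E Y by (meson subset_trans)
    then show False using card_mono[of "{y}" e] by simp
  qed
  have meet: "e \<inter> f \<noteq> {}" if "e \<in> E" "f \<in> E" "e \<subseteq> x" "f \<subseteq> x" for e f
  proof
    assume "e \<inter> f = {}"
    then have "f \<subseteq> sym_diff e x" using that by blast
    then show False using xor[of e] E that by blast
  qed
  have avoid: "\<exists>e \<in> E. e \<subseteq> x - {y}" if "y \<in> x" for y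
  proof -
    have "sym_diff {y} x = x - {y}" using that by blast
    then show ?thesis using xor[of "{y}"] small[of "{y}" y] that x by auto
  qed
  have "\<exists>e \<in> E. e \<subseteq> x" using xor[of "{}"] small[of "{}"] by auto
  then obtain u v where uv: "{u, v} \<in> E" "u \<noteq> v" "{u, v} \<subseteq> x"
    using E by (metis card_2_iff)
  \<comment> \<open>The edge \<open>f\<close> avoids \<open>u\<close> and so meets
    \<open>{u, v}\<close> in \<open>v\<close>; the edge \<open>g\<close> below avoids
    \<open>v\<close> and so closes the triangle.\<close>
  obtain f where f: "f \<in> E" "f \<subseteq> x - {u}" using avoid[of u] uv by auto
  then have "v \<in> f" using meet[of "{u, v}" f] uv by auto
  then obtain w where w: "f = {v, w}" "v \<noteq> w" using E[OF f(1)] by (auto simp: card_2_iff)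
  obtain g where g: "g \<in> E" "g \<subseteq> x - {v}" using avoid[of v] uv by auto
  have "u \<in> g" using meet[of "{u, v}" g] uv g by auto
  moreover have "w \<in> g" using meet[of f g] f w g by auto
  moreover have uw: "u \<noteq> w" using f w by auto
  ultimately have "g = {u, w}" using E[OF g(1)] by (auto simp: card_2_iff)
  have T: "{{u, v}, {v, w}, {u, w}} \<subseteq> E" "{u, v, w} \<subseteq> x"
    using uv f g w \<open>g = {u, w}\<close> by auto
  have "e \<in> {{u, v}, {v, w}, {u, w}}" if e: "e \<in> E" for e
  proof (rule ccontr)
    assume n: "e \<notin> {{u, v}, {v, w}, {u, w}}"
    obtain p q where pq: "e = {p, q}" "p \<noteq> q" using E[OF e] by (auto simp: card_2_iff)
    \<comment> \<open>An edge that is no side has at most one corner and misses the side opposite to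
      it. That side then lies in \<open>e + x\<close>, although \<open>e\<close> itself is an
      edge.\<close>
    have "{u, v} \<inter> e = {} \<or> {v, w} \<inter> e = {} \<or> {u, w} \<inter> e = {}"
      using n pq uv(2) w(2) uw by (auto simp: doubleton_eq_iff)
    then obtain t where "t \<in> E" "t \<subseteq> x" "t \<inter> e = {}" using T by (metis insert_subset empty_subsetI)
    then have "\<exists>t \<in> E. t \<subseteq> sym_diff e x" by (intro bexI[of _ t]) auto
    then show False using xor[of e] E[OF e] e by blast
  qed
  then have "E = {{u, v}, {v, w}, {u, w}}" using T by blast
  then show ?thesis using that[of u v w] T x uv(2) w(2) uw by blast
qed

section \<open>Perfect codes and the structure of the poset\<close>

text \<open>Divide \<open>2 ^ n\<close> by the size of the code. The exponent is an integer
  difference, not truncated at 0; \<open>m \<le> n\<close> follows because the ball has at most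
  \<open>2 ^ n\<close> elements.\<close>

lemma perfect_code_card_ball:
  assumes "perfect_code n P r C" "real (card C) = 2 powi (int n - int m)"
  shows "card (P_ball n P r) = 2 ^ m" "m \<le> n"
proof -
  let ?B = "P_ball n P r"
  have B: "?B \<subseteq> Pow {1..n}" unfolding P_ball_def by blast
  have "card C * card ?B = 2 ^ card {1..n}"
    using assms(1) unfolding perfect_code_iff_tiling by (rule card_tiling) simp
  then have "real (card C) * real (card ?B) = 2 ^ n"
    by (metis card_atLeastAtMost diff_Suc_1 of_nat_mult of_nat_numeral of_nat_power)
  moreover have "real (card C) = 2 ^ n / 2 ^ m"
    using assms(2) by (simp add: power_int_diff)
  ultimately have "real (card ?B) = 2 ^ m" by (simp add: field_simps)
  then show c: "card ?B = 2 ^ m"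
    by (metis of_nat_eq_iff of_nat_numeral of_nat_power)
  have "card ?B \<le> 2 ^ n" using card_mono[OF _ B] by (simp add: card_Pow)
  then show "m \<le> n" using c by simp
qed

text \<open>Restricting the code to \<open>P^r\<close> leaves two codewords. Complements turn
  subsets of ideals of size \<open>r\<close> into sets containing an edge, so
  \<open>graph_is_triangle\<close> applies.\<close>

lemma ideals_of_card_if_perfect:
  assumes po: "partial_order_on {1..n} P" and r: "1 \<le> r" and C: "perfect_code n P r C"
    and card: "real (card C) = 2 powi (int n - int (r + 1))"
  obtains u v w where "u \<in> ideals_union n P r" "v \<in> ideals_union n P r" "w \<in> ideals_union n P r"
    "u \<noteq> v" "v \<noteq> w" "u \<noteq> w" "card (ideals_union n P r) = r + 2" "r \<le> n"
    "ideals_of_card n P r =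
      {ideals_union n P r - {u, v}, ideals_union n P r - {v, w}, ideals_union n P r - {u, w}}"
proof -
  define S B where "S = ideals_union n P r" and "B = P_ball n P r"
  have cB: "card B = 2 ^ (r + 1)" and rn: "r \<le> n"
    using perfect_code_card_ball[OF C card] unfolding B_def by auto
  have cS: "card S = r + 2"
    using card_ideals_union[OF po r rn] cB unfolding B_def S_def by blast
  have finS: "finite S" using cS card.infinite by fastforce
  have BS: "B \<subseteq> Pow S" using P_ball_subset_Pow_ideals_union[OF po rn] unfolding B_def S_def .
  have "S \<subseteq> {1..n}" using poset_ideal_ideals_union poset_ideal_subset unfolding S_def by blast
  then have tile: "tiling S (C \<inter> Pow S) B"
    using C BS unfolding perfect_code_iff_tiling B_def by (intro tiling_restrict)
  have "card (C \<inter> Pow S) * card B = 2 ^ card S"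
    by (rule card_tiling[OF tile finS])
  \<comment> \<open>The quotient of \<open>2 ^ (r + 2)\<close> by
    \<open>2 ^ (r + 1)\<close>.\<close>
  then have c2: "card (C \<inter> Pow S) = 2" using cB cS by simp
  obtain x where x: "x \<subseteq> S" "\<And>Y. Y \<subseteq> S \<Longrightarrow> (Y \<in> B) \<noteq> (sym_diff Y x \<in> B)"
    using two_codewords[OF tile c2] by blast
  define E where "E = (\<lambda>J. S - J) ` ideals_of_card n P r"
  have JS: "J \<subseteq> S" "card J = r" if "J \<in> ideals_of_card n P r" for J
    using that unfolding S_def ideals_union_def ideals_of_card_def by auto
  have E: "e \<subseteq> S \<and> card e = 2" if e: "e \<in> E" for e
  proof -
    obtain J where J: "J \<in> ideals_of_card n P r" "e = S - J" using e unfolding E_def by blast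
    then show ?thesis
      using JS[OF J(1)] cS card_Diff_subset[of J S] finite_subset[OF _ finS] by auto
  qed
  have dep: "(\<exists>e \<in> E. e \<subseteq> Y) \<longleftrightarrow> S - Y \<in> B" for Y
  proof -
    have "S - J \<subseteq> Y \<longleftrightarrow> S - Y \<subseteq> J" for J by blast
    then show ?thesis unfolding E_def B_def mem_P_ball_iff[OF po rn] by simp
  qed
  \<comment> \<open>Complementing in \<open>S\<close> commutes with adding \<open>x\<close>, so the
    alternative between \<open>Y\<close> and \<open>Y + x\<close> carries over from the ball to the
    graph.\<close>
  have xor: "(\<exists>e \<in> E. e \<subseteq> Y) \<noteq> (\<exists>e \<in> E. e \<subseteq> sym_diff Y x)" if Y: "Y \<subseteq> S" for Y
  proof -
    have "S - sym_diff Y x = sym_diff (S - Y) x" using Y x(1) by auto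
    then show ?thesis using x(2)[OF Diff_subset, of Y] unfolding dep by simp
  qed
  obtain u v w where uvw: "u \<in> S" "v \<in> S" "w \<in> S" "u \<noteq> v" "v \<noteq> w" "u \<noteq> w"
    "E = {{u, v}, {v, w}, {u, w}}"
    by (rule graph_is_triangle[OF E x(1) xor])
  have "(\<lambda>e. S - e) ` E = ideals_of_card n P r"
    unfolding E_def image_image using JS(1) by (simp add: double_diff)
  then have "ideals_of_card n P r = {S - {u, v}, S - {v, w}, S - {u, w}}"
    unfolding uvw(7) by simp
  then show ?thesis by (rule that[OF uvw(1-6)[unfolded S_def] cS[unfolded S_def] rn, folded S_def])
qed

section \<open>From a perfect code to the ideal and its three elements\<close>

text \<open>A proper subideal of \<open>J\<close> containing \<open>X\<close> could be enlarged
  within \<open>J\<close> to an ideal of size \<open>r\<close> that still contains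
  \<open>X\<close>.\<close>

lemma ideal_gen_eq_if_card_Suc:
  assumes po: "partial_order_on {1..n} P" and J: "poset_ideal n P J" "card J = Suc r" "X \<subseteq> J"
    and "\<And>K. K \<in> ideals_of_card n P r \<Longrightarrow> \<not> X \<subseteq> K"
  shows "ideal_gen n P X = J"
proof (rule ccontr)
  assume "ideal_gen n P X \<noteq> J"
  moreover have gJ: "ideal_gen n P X \<subseteq> J" using ideal_gen_least J by blast
  ultimately have "ideal_gen n P X \<subset> J" by blast
  then have "card (ideal_gen n P X) < card J"
    by (rule psubset_card_mono[OF poset_ideal_finite[OF J(1)]])
  then have "card (ideal_gen n P X) \<le> r" using J(2) by simp
  moreover have "poset_ideal n P (ideal_gen n P X)"
    using poset_ideal_ideal_gen[OF po subset_trans[OF J(3) poset_ideal_subset[OF J(1)]]] .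
  ultimately obtain K where "poset_ideal n P K" "ideal_gen n P X \<subseteq> K" "card K = r"
    using ideal_interpolate[OF po _ J(1) gJ] J(2) by (metis le_SucI order_refl)
  then show False using assms(5) subset_ideal_gen unfolding ideals_of_card_def by blast
qed

text \<open>\<open>S - {s}\<close> is an ideal of size \<open>r + 1\<close>, being a union of two of
  the listed ideals, and none of the three contains both \<open>p\<close> and
  \<open>q\<close>.\<close>

lemma ideal_gen_pair:
  assumes po: "partial_order_on {1..n} P" and cS: "card S = r + 2"
    and pqs: "p \<in> S" "q \<in> S" "s \<in> S" "p \<noteq> q" "q \<noteq> s" "p \<noteq> s"
    and ids: "ideals_of_card n P r = {S - {p, q}, S - {q, s}, S - {p, s}}"
  shows "ideal_gen n P {p, q} = {p, q} \<union> (S - {p, q, s})"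
proof -
  have "poset_ideal n P (S - {q, s})" "poset_ideal n P (S - {p, s})"
    using ids unfolding ideals_of_card_def by auto
  moreover have "S - {s} = (S - {q, s}) \<union> (S - {p, s})" using pqs by blast
  ultimately have "poset_ideal n P (S - {s})" using poset_ideal_Un by metis
  moreover have "card (S - {s}) = Suc r" using cS pqs by simp
  moreover have "\<not> {p, q} \<subseteq> K" if "K \<in> ideals_of_card n P r" for K
    using that unfolding ids by blast
  ultimately have "ideal_gen n P {p, q} = S - {s}"
    using pqs by (intro ideal_gen_eq_if_card_Suc[OF po]) auto
  also have "\<dots> = {p, q} \<union> (S - {p, q, s})" using pqs by blast
  finally show ?thesis .
qed

text \<open>\<open>I\<close> is the common part of the three ideals of size \<open>m - 1\<close>;
  each of them is \<open>I\<close> together with one \<open>a i\<close>.\<close>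

lemma structure_if_perfect:
  assumes po: "partial_order_on {1..n} P" and m: "m \<ge> 2" and C: "perfect_code n P (m - 1) C"
    and card: "real (card C) = 2 powi (int n - int m)"
  shows "\<exists>I a. I \<in> ideals_of_card n P (m - 2) \<and>
    (\<forall>i \<in> {1, 2, 3 :: nat}. a i \<in> {1..n} - I) \<and>
    inj_on a {1, 2, 3} \<and>
    ideals_union n P (m - 1) = I \<union> {a 1, a 2, a 3} \<and>
    (\<forall>i \<in> {1, 2, 3}. \<forall>j \<in> {1, 2, 3}. i \<noteq> j \<longrightarrow>
      ideal_gen n P {a i, a j} = {a i, a j} \<union> I) \<and>
    (\<forall>b \<in> {1..n} - ideals_union n P (m - 1).
      \<exists>i \<in> {1, 2, 3}. {a i} \<union> I \<subseteq> ideal_gen n P {b})"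
proof -
  define r where "r = m - 1"
  have r: "1 \<le> r" "m = r + 1" "m - 2 = r - 1" using m unfolding r_def by auto
  define S where "S = ideals_union n P r"
  obtain u v w where uvw: "u \<in> S" "v \<in> S" "w \<in> S" "u \<noteq> v" "v \<noteq> w" "u \<noteq> w"
    and cS: "card S = r + 2" and rn: "r \<le> n"
    and ids: "ideals_of_card n P r = {S - {u, v}, S - {v, w}, S - {u, w}}"
    using ideals_of_card_if_perfect[OF po r(1) C[folded r_def] card[unfolded r(2)], folded S_def]
    by blast
  have S: "poset_ideal n P S" unfolding S_def by (rule poset_ideal_ideals_union)
  have Sn: "S \<subseteq> {1..n}" and finS: "finite S"
    using S poset_ideal_subset poset_ideal_finite by blast+
  define I where "I = S - {u, v, w}"
  have idP: "poset_ideal n P (S - {u, v})" "poset_ideal n P (S - {v, w})"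
    "poset_ideal n P (S - {u, w})"
    using ids unfolding ideals_of_card_def by auto
  have "I = (S - {u, v}) \<inter> (S - {v, w})" unfolding I_def by blast
  then have "poset_ideal n P I" using poset_ideal_Int[OF idP(1,2)] by simp
  moreover have "card I = r - 1"
    using uvw cS finS unfolding I_def by (simp add: card_Diff_subset)
  ultimately have I: "I \<in> ideals_of_card n P (r - 1)" unfolding ideals_of_card_def by blast
  have "ideals_of_card n P r = {S - {v, w}, S - {w, u}, S - {v, u}}"
    "ideals_of_card n P r = {S - {u, w}, S - {w, v}, S - {u, v}}"
    using ids by (auto simp: insert_commute)
  then have gen: "ideal_gen n P {u, v} = {u, v} \<union> I" "ideal_gen n P {v, w} = {v, w} \<union> I"
    "ideal_gen n P {u, w} = {u, w} \<union> I"
    using ideal_gen_pair[OF po cS, of u v w] ideal_gen_pair[OF po cS, of v w u]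
      ideal_gen_pair[OF po cS, of u w v] uvw ids
    unfolding I_def by (simp_all add: insert_commute)
  define a where "a = (\<lambda>i :: nat. if i = 1 then u else if i = 2 then v else w)"
  have a: "a 1 = u" "a 2 = v" "a 3 = w" unfolding a_def by auto
  \<comment> \<open>A point outside \<open>S\<close> has weight above \<open>r\<close>, so the ideal
    it generates contains an ideal of size \<open>r\<close>, which must be one of the three.\<close>
  have up: "\<exists>i \<in> {1, 2, 3}. {a i} \<union> I \<subseteq> ideal_gen n P {b}" if b: "b \<in> {1..n} - S" for b
  proof -
    have g: "poset_ideal n P (ideal_gen n P {b})" using poset_ideal_ideal_gen[OF po] b by blast
    have "{b} \<notin> P_ball n P r" using P_ball_subset_Pow_ideals_union[OF po rn] b unfolding S_def by blast
    then have "r \<le> card (ideal_gen n P {b})" using b unfolding P_ball_def P_weight_def by auto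
    moreover have "poset_ideal n P {}" unfolding poset_ideal_def by simp
    ultimately obtain J where "poset_ideal n P J" "J \<subseteq> ideal_gen n P {b}" "card J = r"
      using ideal_interpolate[OF po _ g, of "{}" r] by auto
    then have "S - {u, v} \<subseteq> ideal_gen n P {b} \<or> S - {v, w} \<subseteq> ideal_gen n P {b} \<or>
      S - {u, w} \<subseteq> ideal_gen n P {b}"
      using ids unfolding ideals_of_card_def by blast
    moreover have "S - {u, v} = {w} \<union> I" "S - {v, w} = {u} \<union> I" "S - {u, w} = {v} \<union> I"
      unfolding I_def using uvw by auto
    ultimately show ?thesis using a by auto
  qed
  have "S = I \<union> {u, v, w}" unfolding I_def using uvw by blast
  moreover have "\<forall>i \<in> {1, 2, 3 :: nat}. a i \<in> {1..n} - I"
    using a uvw Sn unfolding I_def by auto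
  moreover have "inj_on a {1, 2, 3}" using a uvw by (simp add: inj_on_def)
  moreover have "\<forall>i \<in> {1, 2, 3}. \<forall>j \<in> {1, 2, 3}. i \<noteq> j \<longrightarrow>
      ideal_gen n P {a i, a j} = {a i, a j} \<union> I"
    using gen a by (simp add: insert_commute)
  ultimately show ?thesis
    using I[folded r(3)] ballI[OF up] unfolding a[symmetric] unfolding S_def r_def
    by (intro exI[of _ I] exI[of _ a] conjI)
qed

section \<open>From the structure to a perfect code\<close>

text \<open>The code is zero on \<open>I\<close>, the threefold repetition code on \<open>T\<close>,
  and free elsewhere. A ball element is an arbitrary subset of \<open>I\<close> with at most one
  point of \<open>T\<close>, so majority decoding on \<open>T\<close> gives the unique
  representation.\<close>

lemma perfect_code_if_structure:
  assumes po: "partial_order_on {1..n} P" and m: "m \<ge> 2"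
    and I: "I \<in> ideals_of_card n P (m - 2)"
    and T: "T \<subseteq> {1..n} - I" "card T = 3"
    and union: "ideals_union n P (m - 1) = I \<union> T"
    and gen: "\<And>p q. p \<in> T \<Longrightarrow> q \<in> T \<Longrightarrow> p \<noteq> q \<Longrightarrow> ideal_gen n P {p, q} = {p, q} \<union> I"
  shows "\<exists>C. perfect_code n P (m - 1) C \<and> real (card C) = 2 powi (int n - int m)"
proof -
  define r where "r = m - 1"
  have r: "1 \<le> r" "m = r + 1" "m - 2 = r - 1" using m unfolding r_def by auto
  have In: "I \<subseteq> {1..n}" "card I = r - 1" "poset_ideal n P I"
    using I r(3) poset_ideal_subset unfolding ideals_of_card_def by auto
  have fin: "finite I" "finite T" using finite_subset[OF In(1)] finite_subset[OF T(1)] by simp_all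
  define S where "S = I \<union> T"
  have Sn: "S \<subseteq> {1..n}" and finS: "finite S" using In T fin unfolding S_def by auto
  have cS: "card S = r + 2"
    unfolding S_def using fin T In(2) r(1) by (subst card_Un_disjoint) auto
  then have mn: "r + 2 \<le> n" using card_mono[OF _ Sn] by simp
  have idT: "poset_ideal n P (insert p I)" if p: "p \<in> T" for p
  proof -
    have "card (T - {p}) = 2" using T(2) p by simp
    then obtain q s where qs: "T - {p} = {q, s}" "q \<noteq> s" by (meson card_2_iff)
    then have "q \<in> T" "s \<in> T" "p \<noteq> q" "p \<noteq> s" by auto
    have "insert p I = ideal_gen n P {p, q} \<inter> ideal_gen n P {p, s}"
      using gen \<open>q \<in> T\<close> \<open>s \<in> T\<close> \<open>p \<noteq> q\<close> \<open>p \<noteq> s\<close> p qs(2) T(1) by auto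
    moreover have "poset_ideal n P (ideal_gen n P {p, q})" "poset_ideal n P (ideal_gen n P {p, s})"
      using p \<open>q \<in> T\<close> \<open>s \<in> T\<close> T(1) by (intro poset_ideal_ideal_gen[OF po]; blast)+
    ultimately show ?thesis using poset_ideal_Int by metis
  qed
  have ball: "X \<in> P_ball n P r \<longleftrightarrow> (\<exists>p \<in> T. X \<subseteq> insert p I)" for X
  proof -
    have "insert p I \<in> ideals_of_card n P r" if "p \<in> T" for p
    proof -
      have "p \<notin> I" using that T(1) by blast
      then show ?thesis using idT[OF that] fin In(2) r(1) unfolding ideals_of_card_def by simp
    qed
    \<comment> \<open>Otherwise \<open>J\<close>, confined to \<open>I \<union> T\<close> by
      \<open>union\<close>, has two points of \<open>T\<close>, hence contains the
      \<open>r + 1\<close> elements they generate.\<close>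
    moreover have "\<exists>p \<in> T. J \<subseteq> insert p I" if J: "J \<in> ideals_of_card n P r" for J
    proof (rule ccontr)
      assume n: "\<not> ?thesis"
      have J': "poset_ideal n P J" "card J = r" "J \<subseteq> I \<union> T"
        using J union unfolding ideals_union_def ideals_of_card_def r_def by auto
      obtain t where "t \<in> T" using T(2) by fastforce
      then obtain p where p: "p \<in> J" "p \<in> T" using n J'(3) by blast
      then obtain q where q: "q \<in> J" "q \<in> T" "q \<noteq> p" using n J'(3) by blast
      have "{p, q} \<union> I \<subseteq> J"
        using gen[of p q] p q ideal_gen_least[OF J'(1), of "{p, q}"] by auto
      then have "card ({p, q} \<union> I) \<le> r"
        using J'(2) card_mono[OF poset_ideal_finite[OF J'(1)]] by blast
      moreover have "card ({p, q} \<union> I) = 2 + (r - 1)"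
        using p q T(1) fin In(2) by (subst card_Un_disjoint) auto
      ultimately show False using r(1) by simp
    qed
    ultimately show ?thesis
      using mem_P_ball_iff[OF po, of r X] mn by (meson add_leD1 subset_trans)
  qed
  \<comment> \<open>\<open>D\<close> holds the free coordinates; the two choices on \<open>T\<close>
    double it, giving \<open>2 * 2 ^ (n - (r + 2)) = 2 ^ (n - m)\<close> codewords.\<close>
  define D where "D = Pow ({1..n} - S)"
  define C where "C = D \<union> (\<union>) T ` D"
  have TS: "T \<subseteq> S" "T \<inter> I = {}" using T(1) unfolding S_def by auto
  have inj: "inj_on ((\<union>) T) D" using TS(1) unfolding D_def by (intro inj_onI) blast
  have "T \<noteq> {}" using T(2) by auto
  have finD: "finite D" unfolding D_def by simp
  have "D \<inter> (\<union>) T ` D = {}" using \<open>T \<noteq> {}\<close> TS(1) unfolding D_def by blast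
  then have "card C = 2 * card D"
    unfolding C_def using finD inj by (simp add: card_Un_disjoint card_image)
  moreover have "card D = 2 ^ (n - (r + 2))"
    unfolding D_def using Sn finS cS by (simp add: card_Pow card_Diff_subset)
  ultimately have "card C = 2 ^ (n - m)"
    using mn r(2) by (simp flip: power_Suc add: Suc_diff_Suc)
  moreover have "int n - int m = int (n - m)" using mn r(2) by simp
  ultimately have card: "real (card C) = 2 powi (int n - int m)"
    by (metis of_nat_numeral of_nat_power power_int_of_nat)
  have Cn: "C \<subseteq> Pow {1..n}" using T(1) unfolding C_def D_def by blast
  have CT: "c \<in> C \<longleftrightarrow> c \<subseteq> {1..n} \<and> c \<inter> I = {} \<and> (c \<inter> T = {} \<or> T \<subseteq> c)" for c
  proof
    assume "c \<in> C" then show "c \<subseteq> {1..n} \<and> c \<inter> I = {} \<and> (c \<inter> T = {} \<or> T \<subseteq> c)"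
      using T(1) unfolding C_def D_def S_def by blast
  next
    assume c: "c \<subseteq> {1..n} \<and> c \<inter> I = {} \<and> (c \<inter> T = {} \<or> T \<subseteq> c)"
    then have "c - T \<in> D" unfolding D_def S_def by blast
    moreover have "c = c - T \<or> c = T \<union> (c - T)" using c by blast
    ultimately show "c \<in> C" unfolding C_def by (metis UnI1 UnI2 imageI)
  qed
  obtain u v w where uvw: "T = {u, v, w}" "u \<noteq> v" "v \<noteq> w" "u \<noteq> w"
    using T(2) by (auto simp: card_3_iff)
  have ex: "\<exists>c \<in> C. \<exists>b \<in> P_ball n P r. x = sym_diff c b" if x: "x \<subseteq> {1..n}" for x
  proof (cases "\<exists>p \<in> T. x \<inter> T \<subseteq> {p}")
    case True
    have "x - S \<in> C" using x unfolding CT S_def by blast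
    moreover have "x \<inter> S \<in> P_ball n P r" using True unfolding ball S_def by blast
    moreover have "x = sym_diff (x - S) (x \<inter> S)" by blast
    ultimately show ?thesis by blast
  next
    \<comment> \<open>Here \<open>x\<close> has at least two of the three points of
      \<open>T\<close>, so the codeword takes all of \<open>T\<close> and the error includes the
      possibly missing point.\<close>
    case False
    have "(x - S) \<union> T \<in> C" using x T(1) unfolding CT S_def by blast
    moreover have "\<exists>p \<in> T. T - x \<subseteq> {p}" using False uvw by auto
    then have "(x \<inter> I) \<union> (T - x) \<in> P_ball n P r" unfolding ball by blast
    moreover have "x = sym_diff ((x - S) \<union> T) ((x \<inter> I) \<union> (T - x))"
      using TS(2) unfolding S_def by blast
    ultimately show ?thesis by blast
  qed
  have un: "c = c' \<and> b = b'"
    if cb: "c \<in> C" "b \<in> P_ball n P r" "c' \<in> C" "b' \<in> P_ball n P r"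
      and eq: "sym_diff c b = sym_diff c' b'" for c b c' b'
  proof -
    obtain p q where pq: "p \<in> T" "b \<subseteq> insert p I" "q \<in> T" "b' \<subseteq> insert q I"
      using cb(2,4) unfolding ball by blast
    \<comment> \<open>The two errors touch at most two points of \<open>T\<close>. At the third
      point \<open>t\<close> the codewords agree, hence they agree on all of
      \<open>T\<close>.\<close>
    obtain t where t: "t \<in> T" "t \<noteq> p" "t \<noteq> q" using uvw by auto
    have off: "y \<in> c \<longleftrightarrow> y \<in> c'" if "y \<notin> b" "y \<notin> b'" for y
    proof -
      have "y \<in> sym_diff c b \<longleftrightarrow> y \<in> sym_diff c' b'" using eq by simp
      then show ?thesis using that by simp
    qed
    have "t \<notin> b" "t \<notin> b'" using t pq TS(2) by auto
    then have tc: "t \<in> c \<longleftrightarrow> t \<in> c'" by (rule off)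
    have "y \<in> c \<longleftrightarrow> y \<in> c'" for y
    proof (cases "y \<in> T \<or> y \<in> I")
      case True
      then show ?thesis using cb(1,3) t(1) tc unfolding CT by blast
    next
      case False
      then have "y \<notin> b" "y \<notin> b'" using pq by auto
      then show ?thesis by (rule off)
    qed
    then have "c = c'" by (rule set_eqI)
    then show ?thesis using eq sym_diff_cancel_left by metis
  qed
  have "P_ball n P r \<subseteq> Pow {1..n}" unfolding P_ball_def by blast
  then have "perfect_code n P r C"
    using ex un Cn unfolding perfect_code_iff_tiling tiling_def by (simp add: Ball_def)
  then show ?thesis using card unfolding r_def by blast
qed

text \<open>The equation for \<open>ideals_union n P r\<close> carries content of its own: on an
  antichain of four points with \<open>m = 2\<close>, the empty ideal and any three points satisfy
  the other clauses, yet the ball has 5 elements and 5 does not divide 16.\<close>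

theorem theorem2:
  fixes n m r :: nat and P :: "nat rel"
  assumes "partial_order_on {1..n} P"
    and "m \<ge> 2"
    and "r = m - 1"
  shows "(\<exists>C. perfect_code n P (m - 1) C \<and> real (card C) = 2 powi (int n - int m)) \<longleftrightarrow>
    (\<exists>I a. I \<in> ideals_of_card n P (m - 2) \<and>
       (\<forall>i \<in> {1, 2, 3 :: nat}. a i \<in> {1..n} - I) \<and>
       inj_on a {1, 2, 3} \<and>
       ideals_union n P r = I \<union> {a 1, a 2, a 3} \<and>
       (\<forall>i \<in> {1, 2, 3}. \<forall>j \<in> {1, 2, 3}. i \<noteq> j \<longrightarrow>
          ideal_gen n P {a i, a j} = {a i, a j} \<union> I) \<and>
       (\<forall>b \<in> {1..n} - ideals_union n P r.
          \<exists>i \<in> {1, 2, 3}. {a i} \<union> I \<subseteq> ideal_gen n P {b}))"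
    (is "?L \<longleftrightarrow> ?R")
proof
  assume ?L
  then show ?R
    using structure_if_perfect[OF assms(1,2)] unfolding assms(3) by blast
next
  assume ?R
  then obtain I a where H: "I \<in> ideals_of_card n P (m - 2)"
    "\<forall>i \<in> {1, 2, 3 :: nat}. a i \<in> {1..n} - I" "inj_on a {1, 2, 3}"
    "ideals_union n P r = I \<union> {a 1, a 2, a 3}"
    "\<forall>i \<in> {1, 2, 3}. \<forall>j \<in> {1, 2, 3}. i \<noteq> j \<longrightarrow> ideal_gen n P {a i, a j} = {a i, a j} \<union> I"
    by metis
  show ?L
  proof (rule perfect_code_if_structure[OF assms(1,2) H(1), of "a ` {1, 2, 3}"])
    show "a ` {1, 2, 3} \<subseteq> {1..n} - I" using H(2) by blast
    show "card (a ` {1, 2, 3}) = 3" using card_image[OF H(3)] by simp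
    show "ideals_union n P (m - 1) = I \<union> a ` {1, 2, 3}" using H(4) assms(3) by simp
    show "ideal_gen n P {p, q} = {p, q} \<union> I"
      if pq: "p \<in> a ` {1, 2, 3}" "q \<in> a ` {1, 2, 3}" "p \<noteq> q" for p q
    proof -
      obtain i j where ij: "i \<in> {1, 2, 3}" "p = a i" "j \<in> {1, 2, 3}" "q = a j"
        using pq(1,2) by blast
      then have "i \<noteq> j" using pq(3) by blast
      then show ?thesis using bspec[OF bspec[OF H(5) ij(1)] ij(3)] ij(2,4) by simp
    qed
  qed
qed

end
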